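(* Let $p$ be an odd prime and let $e$ be a divisor of $p-1$ such that $f=\frac{p-1}{e}$ is of the form $2^r$ with $r\ge 1$. Let $g$ be a primitive root modulo $p^2$, let $b$ be an integer with $0\le b\le pf-1$, and let $\mathbf{s}^\infty$ be the generalized cyclotomic binary sequence of period $p^2$ with characteristic set $C_1$ (defined in the context). If $2^e\equiv 1\pmod{p^2}$, then $L(\mathbf{s}^\infty)=\frac{p^2+1}{2}$.
   Context: For $j\in\{1,2\}$ let $d_j=p^{j-1}f$, let $D_0^{(p^j)}=\{g^{d_j t}\bmod p^j : 0\le t<e\}$ and $D_i^{(p^j)}=\{g^i x \bmod p^j : x\in D_0^{(p^j)}\}$ for integers $i$; subscripts of $D^{(p^j)}$ are taken modulo $d_j$. For $D\subseteq\mathbb{Z}_p$, $pD=\{px: x\in D\}\subseteq\mathbb{Z}_{p^2}$. Define $C_1=\{0\}\cup\bigcup_{i=0}^{f/2-1} pD^{(p)}_{(i+b)\bmod f}\cup\bigcup_{i=0}^{pf/2-1} D^{(p^2)}_{(i+b)\bmod pf}\subseteq\mathbb{Z}_{p^2}$, and the binary sequence $\mathbf{s}^\infty=(s_0,s_1,\dots)$ by $s_i=1$ if $i\bmod p^2\in C_1$ and $s_i=0$ otherwise. The linear complexity $L(\mathbf{s}^\infty)$ is the length of the shortest linear feedback shift register over $\mathbb{F}_2$ generating the sequence; equivalently $p^2-\deg\gcd(x^{p^2}-1,s(x))$ with $s(x)=\sum_{i=0}^{p^2-1}s_ix^i\in\mathbb{F}_2[x]$. *)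

theory Defs
  imports "HOL-Number_Theory.Number_Theory" "HOL-Library.Z2"
begin

text \<open>
  Residues modulo \<open>n\<close> are represented by the natural numbers below \<open>n\<close>, and
  the field with two elements is the type \<^typ>\<open>bit\<close>.
  For \<open>j \<in> {1, 2}\<close>, \<open>cyc_class p e f g j i\<close> is the generalized cyclotomic class of index \<open>i\<close>
  modulo \<open>p ^ j\<close>. Indices are natural numbers; since they are read modulo \<open>d\<^sub>j\<close>, negative
  ones are not needed.
\<close>

definition cyc_d :: "nat \<Rightarrow> nat \<Rightarrow> nat \<Rightarrow> nat" where
  "cyc_d p f j = p ^ (j - 1) * f"

definition cyc_class0 :: "nat \<Rightarrow> nat \<Rightarrow> nat \<Rightarrow> nat \<Rightarrow> nat \<Rightarrow> nat set" where
  "cyc_class0 p e f g j = {g ^ (cyc_d p f j * t) mod p ^ j | t. t < e}"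

definition cyc_class :: "nat \<Rightarrow> nat \<Rightarrow> nat \<Rightarrow> nat \<Rightarrow> nat \<Rightarrow> nat \<Rightarrow> nat set" where
  "cyc_class p e f g j i = {g ^ i * x mod p ^ j | x. x \<in> cyc_class0 p e f g j}"

definition char_set :: "nat \<Rightarrow> nat \<Rightarrow> nat \<Rightarrow> nat \<Rightarrow> nat \<Rightarrow> nat set" where
  "char_set p e f g b =
     {0} \<union> (\<Union>i\<in>{0..<f div 2}. (\<lambda>x. p * x) ` cyc_class p e f g 1 ((i + b) mod f))
         \<union> (\<Union>i\<in>{0..<p * f div 2}. cyc_class p e f g 2 ((i + b) mod (p * f)))"

definition cyc_seq :: "nat \<Rightarrow> nat \<Rightarrow> nat \<Rightarrow> nat \<Rightarrow> nat \<Rightarrow> nat \<Rightarrow> bit" where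
  "cyc_seq p e f g b i = (if i mod p\<^sup>2 \<in> char_set p e f g b then 1 else 0)"

text \<open>
  A linear feedback shift register of length \<open>L\<close> with feedback coefficients
  \<open>c 0, \<dots>, c (L - 1)\<close> and initial state \<open>s 0, \<dots>, s (L - 1)\<close>. No coefficient is required
  to be nonzero, and a register of length \<open>0\<close> generates the zero sequence.
\<close>

definition lfsr_generates :: "nat \<Rightarrow> (nat \<Rightarrow> bit) \<Rightarrow> (nat \<Rightarrow> bit) \<Rightarrow> bool" where
  "lfsr_generates L c s \<longleftrightarrow> (\<forall>i. s (i + L) = (\<Sum>j<L. c j * s (i + j)))"

definition linear_complexity :: "(nat \<Rightarrow> bit) \<Rightarrow> nat" where
  "linear_complexity s = (LEAST L. \<exists>c. lfsr_generates L c s)"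

text \<open>The minimum is attained for every periodic sequence, in particular for \<^const>\<open>cyc_seq\<close>.\<close>

lemma periodic_lfsr_generates:
  assumes "N > 0" and "\<And>i. s (i + N) = s i"
  shows "lfsr_generates N (\<lambda>j. if j = 0 then 1 else 0) s"
proof -
  have "(\<Sum>j<N. (if j = 0 then 1 else 0) * s (i + j)) = s i" for i
  proof -
    have "(\<Sum>j<N. (if j = 0 then 1 else 0) * s (i + j)) = (\<Sum>j<N. if j = 0 then s (i + j) else 0)"
      by (intro sum.cong) auto
    also have "\<dots> = s i"
      using assms(1) by (simp add: sum.delta)
    finally show ?thesis .
  qed
  then show ?thesis
    using assms(2) by (simp add: lfsr_generates_def del: mult_bit_eq_and)
qed

lemma cyc_seq_lfsr_generates:
  assumes "p > 0"
  shows "\<exists>c. lfsr_generates (p\<^sup>2) c (cyc_seq p e f g b)"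
proof -
  have "lfsr_generates (p\<^sup>2) (\<lambda>j. if j = 0 then 1 else 0) (cyc_seq p e f g b)"
    by (rule periodic_lfsr_generates) (use assms in \<open>simp_all add: cyc_seq_def\<close>)
  then show ?thesis
    by blast
qed

end

theory Submission
  imports Defs "HOL-Computational_Algebra.Polynomial"
begin

text \<open>
  Put \<open>N = p\<^sup>2\<close> and let \<open>S\<close> be the sum of the \<open>X ^ k\<close> with \<open>k\<close> in the characteristic set, in
  \<open>R = F\<^sub>2[X] / (X ^ N - 1)\<close>. The linear complexity is the dimension of the ideal \<open>S R\<close>, that is,
  \<open>N\<close> minus the dimension of the annihilator of \<open>S\<close>. No extension field is needed:
  since \<open>2 ^ e = 1\<close> modulo \<open>N\<close>, the number \<open>2\<close> is a power of \<open>g\<close> whose exponent is divisible by \<open>p f\<close>, so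
  the characteristic set is closed under doubling and \<open>S\<^sup>2 = S\<close>. Hence the annihilators of \<open>S\<close> and
  \<open>1 + S\<close> are complementary. Multiplication by \<open>u = g ^ (p f / 2)\<close> interchanges the
  nonzero elements of the characteristic set with its complement, so
  \<open>1 + S = S(X ^ u) + J\<close> with \<open>J = 1 + X + \<dots> + X ^ (N - 1)\<close>. As the characteristic set has odd size,
  \<open>J\<close> is fixed by multiplication by \<open>S(X ^ u)\<close>, and the annihilator of \<open>1 + S\<close>
  has dimension one more than that of \<open>S(X ^ u)\<close>, which has the dimension of that of \<open>S\<close>. If \<open>d\<close> is
  the latter dimension, then \<open>N = 2 d + 1\<close> and the linear complexity is \<open>N - d\<close>.
\<close>

section \<open>Annihilators modulo a polynomial over the two-element field\<close>

declare add_bit_eq_xor [simp del] mult_bit_eq_and [simp del]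

abbreviation X :: "bit poly" where "X \<equiv> [:0, 1:]"

lemma add_self_bit_poly [simp]: "q + q = 0" for q :: "bit poly"
proof -
  have "c + c = 0" for c :: bit by (simp flip: mult_2)
  then show ?thesis by (intro poly_eqI) (simp only: coeff_add coeff_0)
qed

lemma two_bit_poly [simp]: "2 = (0 :: bit poly)"
  using add_self_bit_poly[of 1] by (simp only: one_add_one)

lemma diff_bit_poly: "q - r = q + r" for q r :: "bit poly"
  by (simp add: diff_eq_eq add.assoc)

text \<open>Phrased with coefficients rather than \<open>degree\<close>, so that 0 is included even
  for \<open>n = 0\<close> and closure under addition is immediate.\<close>

definition poly_below :: "nat \<Rightarrow> bit poly set" where
  "poly_below n = {q. \<forall>i\<ge>n. coeff q i = 0}"

lemma poly_below_iff: "q \<in> poly_below n \<longleftrightarrow> q = 0 \<or> degree q < n"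
proof
  assume "q \<in> poly_below n"
  then show "q = 0 \<or> degree q < n"
    using leading_coeff_0_iff[of q] by (auto simp: poly_below_def not_less[symmetric])
qed (auto simp: poly_below_def coeff_eq_0)

lemma poly_below_Suc: "poly_below (Suc n) = (\<lambda>(a, q). pCons a q) ` (UNIV \<times> poly_below n)"
proof (intro equalityI subsetI)
  fix q assume q: "q \<in> poly_below (Suc n)"
  obtain a r where ar: "q = pCons a r" by (cases q)
  have "r \<in> poly_below n"
    unfolding poly_below_def
  proof safe
    fix i assume "n \<le> i"
    then have "coeff q (Suc i) = 0" using q by (simp add: poly_below_def)
    then show "coeff r i = 0" by (simp add: ar)
  qed
  then show "q \<in> (\<lambda>(a, q). pCons a q) ` (UNIV \<times> poly_below n)" using ar by auto
next
  fix q assume "q \<in> (\<lambda>(a, q). pCons a q) ` (UNIV \<times> poly_below n)"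
  then show "q \<in> poly_below (Suc n)"
    by (auto simp: poly_below_def coeff_pCons split: nat.splits)
qed

lemma UNIV_bit: "(UNIV :: bit set) = {0, 1}"
  using bit.exhaust by blast

lemma card_poly_below: "finite (poly_below n) \<and> card (poly_below n) = 2 ^ n"
proof (induction n)
  case 0
  have "poly_below 0 = {0}" by (auto simp: poly_below_iff)
  then show ?case by simp
next
  case (Suc n)
  have "inj_on (\<lambda>(a, q). pCons a q) (UNIV \<times> poly_below n)" by (auto simp: inj_on_def)
  then show ?case using Suc by (simp add: poly_below_Suc card_image card_cartesian_product UNIV_bit)
qed

lemma poly_below_add: "q \<in> poly_below n \<Longrightarrow> r \<in> poly_below n \<Longrightarrow> q + r \<in> poly_below n"
  by (simp add: poly_below_def)

lemma mod_in_poly_below: "m \<noteq> 0 \<Longrightarrow> q mod m \<in> poly_below (degree m)"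
  using degree_mod_less[of m q] by (auto simp: poly_below_iff)

lemma poly_below_cong_0:
  assumes "q \<in> poly_below (degree m)" and "m dvd q"
  shows "q = 0"
  using dvd_imp_degree_le[OF assms(2)] assms(1) by (cases "q = 0") (simp_all add: poly_below_iff)

lemma poly_below_cong_imp_eq:
  assumes "q \<in> poly_below (degree m)" "r \<in> poly_below (degree m)" "[q = r] (mod m)"
  shows "q = r"
proof -
  have "q - r \<in> poly_below (degree m)"
    using poly_below_add[OF assms(1,2)] by (simp only: diff_bit_poly)
  moreover have "m dvd q - r" using assms(3) by (simp only: cong_iff_dvd_diff)
  ultimately have "q - r = 0" by (rule poly_below_cong_0)
  then show ?thesis by simp
qed

lemma poly_below_mod: "q \<in> poly_below (degree m) \<Longrightarrow> q mod m = q"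
  by (cases "m = 0") (auto simp: poly_below_iff mod_poly_less)

text \<open>Classes modulo \<open>m\<close> are represented by their remainders. Dimensions over F_2
  are seen only through cardinalities: dimension k means 2^k elements.\<close>

definition annihilator :: "bit poly \<Rightarrow> bit poly \<Rightarrow> bit poly set" where
  "annihilator m t = {q \<in> poly_below (degree m). m dvd q * t}"

lemma finite_annihilator: "finite (annihilator m t)"
  unfolding annihilator_def using card_poly_below by simp

lemma annihilator_cong: "[s = t] (mod m) \<Longrightarrow> annihilator m s = annihilator m t"
  unfolding annihilator_def by (simp add: cong_dvd_iff[OF cong_scalar_left])

lemma mod_in_annihilator:
  assumes "m \<noteq> 0" "m dvd q * t"
  shows "q mod m \<in> annihilator m t"
proof -
  have "[q mod m * t = q * t] (mod m)" by (intro cong_mult) auto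
  then show ?thesis using assms by (auto simp: annihilator_def mod_in_poly_below cong_dvd_iff)
qed

text \<open>The polynomials q with \<open>m dvd q * t\<close> form an ideal, generated by any
  nonzero member h of least degree \<open>L\<close>. The annihilator thus consists of the products h
  * r with r below degree \<open>degree m - L\<close>.\<close>

lemma card_annihilator_Least:
  fixes m t :: "bit poly"
  assumes "m \<noteq> 0"
  defines "L \<equiv> LEAST l. \<exists>q. q \<noteq> 0 \<and> degree q = l \<and> m dvd q * t"
  shows "L \<le> degree m" and "card (annihilator m t) = 2 ^ (degree m - L)"
proof -
  let ?P = "\<lambda>l. \<exists>q. q \<noteq> 0 \<and> degree q = l \<and> m dvd q * t"
  have Pm: "?P (degree m)" using assms(1) by auto
  show le: "L \<le> degree m" unfolding L_def by (rule Least_le[of ?P]) (rule Pm)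
  obtain h where h: "h \<noteq> 0" "degree h = L" "m dvd h * t"
    using LeastI[of ?P, OF Pm] unfolding L_def by blast
  \<comment> \<open>The remainder of q modulo h also kills t, so by minimality of the degree of h it
    must be 0.\<close>
  have min: "h dvd q" if "m dvd q * t" for q
  proof -
    have "q mod h * t = q * t - q div h * (h * t)"
      by (metis add_diff_cancel_left' distrib_right div_mult_mod_eq mult.assoc)
    then have "m dvd q mod h * t" using that h(3) by (metis dvd_diff dvd_mult)
    then have "q mod h = 0"
      using Least_le[of ?P "degree (q mod h)"] degree_mod_less[OF h(1), of q] h(2)
      unfolding L_def by (metis leD)
    then show ?thesis by auto
  qed
  have "annihilator m t = (\<lambda>q. h * q) ` poly_below (degree m - L)"
  proof (intro equalityI subsetI)
    fix q assume q: "q \<in> annihilator m t"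
    then obtain r where r: "q = h * r" using min unfolding annihilator_def by blast
    then have "r \<in> poly_below (degree m - L)"
      using q h(1,2) by (cases "r = 0") (auto simp: annihilator_def poly_below_iff degree_mult_eq)
    then show "q \<in> (\<lambda>q. h * q) ` poly_below (degree m - L)" using r by blast
  next
    fix q assume "q \<in> (\<lambda>q. h * q) ` poly_below (degree m - L)"
    then obtain r where r: "q = h * r" "r \<in> poly_below (degree m - L)" by blast
    have "m dvd q * t" using r(1) h(3) by (metis dvd_mult mult.assoc mult.commute)
    moreover have "q \<in> poly_below (degree m)"
      using r h(1,2) le by (cases "r = 0") (auto simp: poly_below_iff degree_mult_eq)
    ultimately show "q \<in> annihilator m t" by (simp add: annihilator_def)
  qed
  moreover have "inj_on (\<lambda>q. h * q) (poly_below (degree m - L))" using h(1) by (auto simp: inj_on_def)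
  ultimately show "card (annihilator m t) = 2 ^ (degree m - L)"
    using card_poly_below by (simp add: card_image)
qed

text \<open>An idempotent splits the quotient ring: q = q(1 + t) + qt, where the first summand is
  killed by t and the second by 1 + t. Addition is therefore a bijection from the product of the two
  annihilators onto all remainders.\<close>

lemma card_annihilator_idempotent:
  assumes "m \<noteq> 0" and idem: "[t * t = t] (mod m)"
  shows "card (annihilator m t) * card (annihilator m (1 + t)) = 2 ^ degree m"
proof -
  let ?A = "annihilator m t" and ?B = "annihilator m (1 + t)"
  have tt: "m dvd t * (1 + t)"
    using idem by (simp add: cong_iff_dvd_diff diff_bit_poly algebra_simps)
  have inj: "inj_on (\<lambda>(q, r). q + r) (?A \<times> ?B)"
  proof (rule inj_onI, clarify)
    fix q r q' r' assume A: "q \<in> ?A" "r \<in> ?B" "q' \<in> ?A" "r' \<in> ?B" and e: "q + r = q' + r'"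
    have rr: "q + q' = r + r'"
      using e by (metis (no_types) add.assoc add.commute add.left_neutral add_self_bit_poly)
    have "m dvd (q + q') * t" using A by (auto simp: annihilator_def distrib_right)
    moreover have "m dvd (q + q') * (1 + t)"
      unfolding rr using A by (auto simp: annihilator_def distrib_right)
    \<comment> \<open>An element killed by both t and 1 + t is killed by 1, so the two annihilators
      meet only in 0.\<close>
    ultimately have "m dvd (q + q') * (1 + t) - (q + q') * t" by (rule dvd_diff[rotated])
    then have "m dvd q + q'" by (simp add: algebra_simps)
    then have "q + q' = 0"
      using A by (intro poly_below_cong_0[of _ m] poly_below_add) (auto simp: annihilator_def)
    then show "q = q' \<and> r = r'" using rr by (metis add.right_neutral add.assoc add_self_bit_poly add.left_neutral)
  qed
  have "(\<lambda>(q, r). q + r) ` (?A \<times> ?B) = poly_below (degree m)"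
  proof (intro equalityI subsetI)
    fix q assume q: "q \<in> poly_below (degree m)"
    let ?a = "q * (1 + t) mod m" and ?b = "q * t mod m"
    have "m dvd q * (1 + t) * t" using tt by (metis dvd_mult mult.assoc mult.commute)
    moreover have "m dvd q * t * (1 + t)" using tt by (metis dvd_mult mult.assoc)
    ultimately have "?a \<in> ?A" "?b \<in> ?B" using assms(1) by (auto intro!: mod_in_annihilator)
    moreover have "?a + ?b = q"
    proof -
      have "?a + ?b = (q * (1 + t) + q * t) mod m" by (simp add: poly_mod_add_left)
      also have "q * (1 + t) + q * t = q" by (simp add: algebra_simps add.assoc[symmetric])
      finally show ?thesis using q by (simp add: poly_below_mod)
    qed
    ultimately show "q \<in> (\<lambda>(q, r). q + r) ` (?A \<times> ?B)" by force
  qed (auto simp: annihilator_def intro: poly_below_add)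
  then show ?thesis
    using card_image[OF inj] card_poly_below[of "degree m"] by (simp add: card_cartesian_product)
qed

text \<open>By \<open>aj\<close> the ideal of j is {0, j}, and t acts on it as the identity. Hence j
  lies in the annihilator of t + j but not in that of t, and the former is the disjoint union of the
  latter and its translate by j.\<close>

lemma card_annihilator_add:
  assumes j: "j \<in> poly_below (degree m)" "j \<noteq> 0"
    and tj: "[t * j = j] (mod m)" and jj: "[j * j = j] (mod m)"
    and aj: "\<And>a. [a * j = 0] (mod m) \<or> [a * j = j] (mod m)"
  shows "card (annihilator m (t + j)) = 2 * card (annihilator m t)"
proof -
  let ?A = "annihilator m t" and ?B = "annihilator m (t + j)"
  have kill: "m dvd a * j" if "m dvd a * t" for a
  proof -
    have "m dvd a * t * j" using that by simp
    moreover have "[a * t * j = a * j] (mod m)"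
      using cong_scalar_left[OF tj, of a] by (simp add: mult.assoc)
    ultimately show ?thesis by (simp add: cong_dvd_iff)
  qed
  have "\<not> m dvd j" using j poly_below_cong_0 by blast
  then have nA: "\<not> m dvd j * t" using tj by (simp add: cong_dvd_iff mult.commute)
  have jB: "m dvd j * (t + j)"
  proof -
    have "[j * t + j * j = j + j] (mod m)" using tj jj by (intro cong_add) (simp_all add: mult.commute)
    then show ?thesis by (simp add: distrib_left cong_0_iff)
  qed
  have "?B = ?A \<union> (\<lambda>q. q + j) ` ?A"
  proof (intro equalityI subsetI)
    fix a assume a: "a \<in> ?B"
    then have aB: "a \<in> poly_below (degree m)" "m dvd a * t + a * j" by (auto simp: annihilator_def distrib_left)
    consider "m dvd a * j" | "[a * j = j] (mod m)" using aj[of a] by (auto simp: cong_0_iff)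
    then show "a \<in> ?A \<union> (\<lambda>q. q + j) ` ?A"
    proof cases
      case 1
      then have "a \<in> ?A" using aB by (simp add: annihilator_def dvd_add_left_iff)
      then show ?thesis by simp
    next
      case 2
      \<comment> \<open>Here aj = j = jt, so (a + j)t = at + aj = 0 and a lies in the
        translate.\<close>
      have "[(a * t + a * j) + (a * j + j * t) = 0 + (j + j)] (mod m)"
        using 2 aB(2) tj by (intro cong_add) (auto simp: cong_0_iff mult.commute)
      moreover have "(a * t + a * j) + (a * j + j * t) = (a + j) * t"
        by (simp add: algebra_simps)
      ultimately have "m dvd (a + j) * t" by (simp add: cong_0_iff)
      then have "a + j \<in> ?A" using aB j by (auto simp: annihilator_def intro: poly_below_add)
      moreover have "a = (a + j) + j" by (simp add: add.assoc)
      ultimately show ?thesis by blast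
    qed
  next
    fix a assume "a \<in> ?A \<union> (\<lambda>q. q + j) ` ?A"
    moreover have "b \<in> ?B" if "b \<in> ?A" for b
      using that kill[of b] by (auto simp: annihilator_def distrib_left)
    moreover have "b + j \<in> ?B" if "b \<in> ?B" for b
      using that j jB by (auto simp: annihilator_def distrib_right[of b j] intro: poly_below_add)
    ultimately show "a \<in> ?B" by blast
  qed
  moreover have "?A \<inter> (\<lambda>q. q + j) ` ?A = {}"
  proof (rule ccontr)
    assume "?A \<inter> (\<lambda>q. q + j) ` ?A \<noteq> {}"
    then obtain b where "m dvd b * t" "m dvd (b + j) * t" by (auto simp: annihilator_def)
    then show False using nA by (simp add: distrib_right dvd_add_right_iff)
  qed
  moreover have "inj_on (\<lambda>q. q + j) ?A" by (auto simp: inj_on_def)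
  ultimately show ?thesis by (simp add: card_Un_disjoint finite_annihilator card_image)
qed

section \<open>Cyclic polynomials and feedback registers\<close>

definition cyclic_modulus :: "nat \<Rightarrow> bit poly" where
  "cyclic_modulus n = X ^ n - 1"

lemma degree_cyclic_modulus [simp]: "n > 0 \<Longrightarrow> degree (cyclic_modulus n) = n"
  unfolding cyclic_modulus_def diff_bit_poly
  by (subst degree_add_eq_left) (simp_all add: degree_power_eq)

lemma cyclic_modulus_nonzero: "n > 0 \<Longrightarrow> cyclic_modulus n \<noteq> 0"
  using degree_cyclic_modulus[of n] by fastforce

lemma X_power_cong_1: "[X ^ n = 1] (mod cyclic_modulus n)"
  by (simp add: cong_iff_dvd_diff cyclic_modulus_def)

lemma X_power_cong:
  assumes "[a = b] (mod n)"
  shows "[X ^ a = X ^ b] (mod cyclic_modulus n)"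
proof -
  have *: "[X ^ a = X ^ (a mod n)] (mod cyclic_modulus n)" for a
  proof -
    have "[(X ^ n) ^ (a div n) * X ^ (a mod n) = 1 ^ (a div n) * X ^ (a mod n)] (mod cyclic_modulus n)"
      by (intro cong_mult cong_pow X_power_cong_1 cong_refl)
    then show ?thesis by (simp flip: power_mult power_add)
  qed
  show ?thesis using *[of a] *[of b] assms by (metis cong_def)
qed

section \<open>Substituting powers of X modulo X^n - 1\<close>

lemma pcompose_X_power: "X ^ a \<circ>\<^sub>p q = q ^ a"
  by (induction a) (simp_all add: pcompose_mult pcompose_1 pcompose_pCons)

lemma pcompose_cong_right:
  assumes "[r = s] (mod m)"
  shows "[q \<circ>\<^sub>p r = q \<circ>\<^sub>p s] (mod m)"
proof (induction q)
  case (pCons a q)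
  then show ?case using assms by (auto simp: pcompose_pCons intro!: cong_add cong_mult)
qed simp

text \<open>The substitution descends to the quotient because X^n - 1 divides X^(un) - 1.\<close>

lemma pcompose_X_power_cong:
  assumes "[q = r] (mod cyclic_modulus n)"
  shows "[q \<circ>\<^sub>p X ^ u = r \<circ>\<^sub>p X ^ u] (mod cyclic_modulus n)"
proof -
  have "[X ^ (u * n) = X ^ 0] (mod cyclic_modulus n)" by (rule X_power_cong) (simp add: cong_0_iff)
  moreover have "X ^ n \<circ>\<^sub>p X ^ u = X ^ (u * n)" by (simp add: pcompose_X_power power_mult)
  ultimately have "cyclic_modulus n dvd cyclic_modulus n \<circ>\<^sub>p X ^ u"
    by (simp add: cyclic_modulus_def pcompose_diff pcompose_1 cong_iff_dvd_diff)
  also have "\<dots> dvd (q - r) \<circ>\<^sub>p X ^ u"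
    using assms by (auto simp: cong_iff_dvd_diff pcompose_mult elim!: dvdE)
  finally show ?thesis by (simp add: cong_iff_dvd_diff pcompose_diff)
qed

lemma pcompose_X_power_pcompose:
  assumes "[u * v = 1] (mod n)"
  shows "[q \<circ>\<^sub>p X ^ u \<circ>\<^sub>p X ^ v = q] (mod cyclic_modulus n)"
proof -
  have "X ^ u \<circ>\<^sub>p X ^ v = X ^ (u * v)"
    unfolding pcompose_X_power by (simp add: mult.commute flip: power_mult)
  then have "q \<circ>\<^sub>p X ^ u \<circ>\<^sub>p X ^ v = q \<circ>\<^sub>p X ^ (u * v)" by (simp flip: pcompose_assoc)
  moreover have "[q \<circ>\<^sub>p X ^ (u * v) = q \<circ>\<^sub>p X ^ 1] (mod cyclic_modulus n)"
    by (intro pcompose_cong_right X_power_cong assms)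
  ultimately show ?thesis by simp
qed

text \<open>Substituting X^u sends the annihilator of t into that of t(X^u), injectively since X^v
  undoes it. Exchanging u and v later gives the reverse inequality.\<close>

lemma card_annihilator_pcompose_le:
  assumes "n > 0" and uv: "[u * v = 1] (mod n)"
  shows "card (annihilator (cyclic_modulus n) t) \<le> card (annihilator (cyclic_modulus n) (t \<circ>\<^sub>p X ^ u))"
proof -
  let ?m = "cyclic_modulus n"
  let ?f = "\<lambda>q. q \<circ>\<^sub>p X ^ u mod ?m"
  have "?f ` annihilator ?m t \<subseteq> annihilator ?m (t \<circ>\<^sub>p X ^ u)"
  proof safe
    fix q assume "q \<in> annihilator ?m t"
    then have "[q * t = 0] (mod ?m)" by (auto simp: annihilator_def cong_0_iff)
    from pcompose_X_power_cong[OF this, of u] show "?f q \<in> annihilator ?m (t \<circ>\<^sub>p X ^ u)"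
      by (intro mod_in_annihilator cyclic_modulus_nonzero assms) (simp add: pcompose_mult cong_0_iff)
  qed
  moreover have "inj_on ?f (annihilator ?m t)"
  proof (rule inj_onI)
    fix q r assume qr: "q \<in> annihilator ?m t" "r \<in> annihilator ?m t" and e: "?f q = ?f r"
    have "[q \<circ>\<^sub>p X ^ u \<circ>\<^sub>p X ^ v = r \<circ>\<^sub>p X ^ u \<circ>\<^sub>p X ^ v] (mod ?m)"
      using e by (intro pcompose_X_power_cong[of "q \<circ>\<^sub>p X ^ u"]) (simp add: cong_def)
    then have "[q = r] (mod ?m)"
      using pcompose_X_power_pcompose[OF uv] by (metis cong_def)
    then show "q = r" using qr poly_below_cong_imp_eq by (auto simp: annihilator_def)
  qed
  ultimately show ?thesis using finite_annihilator card_inj_on_le by blast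
qed

lemma card_annihilator_pcompose:
  assumes n: "n > 0" and "coprime u n"
  shows "card (annihilator (cyclic_modulus n) (t \<circ>\<^sub>p X ^ u)) = card (annihilator (cyclic_modulus n) t)"
proof -
  obtain v where uv: "[u * v = 1] (mod n)"
    using cong_solve_coprime_nat[OF assms(2)] by auto
  then have vu: "[v * u = 1] (mod n)" by (simp add: mult.commute)
  have "card (annihilator (cyclic_modulus n) (t \<circ>\<^sub>p X ^ u)) \<le>
      card (annihilator (cyclic_modulus n) (t \<circ>\<^sub>p X ^ u \<circ>\<^sub>p X ^ v))"
    by (rule card_annihilator_pcompose_le[OF n vu])
  also have "\<dots> = card (annihilator (cyclic_modulus n) t)"
    using annihilator_cong[OF pcompose_X_power_pcompose[OF uv]] by simp
  finally show ?thesis using card_annihilator_pcompose_le[OF n uv, of t] by simp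
qed

section \<open>Generating polynomials and linear complexity\<close>

definition seq_poly :: "nat \<Rightarrow> (nat \<Rightarrow> bit) \<Rightarrow> bit poly" where
  "seq_poly n s = (\<Sum>k<n. smult (s k) (X ^ k))"

lemma coeff_X_power: "coeff (X ^ k) i = (if i = k then 1 else 0)"
  by (metis coeff_monom monom_altdef smult_1_left)

lemma coeff_seq_poly: "coeff (seq_poly n s) i = (if i < n then s i else 0)"
  by (simp add: seq_poly_def coeff_sum coeff_X_power if_distrib cong: if_cong)

lemma seq_poly_below: "seq_poly n s \<in> poly_below n"
  by (simp add: poly_below_def coeff_seq_poly)

text \<open>
  Substituting \<open>X ^ (n - 1)\<close>, an inverse of \<open>X\<close> modulo \<open>X ^ n - 1\<close>, reverses the sequence, so
  that multiplication by \<open>X\<close> acts as the shift \<open>s i \<mapsto> s (i + 1)\<close> of a feedback register.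
\<close>

lemma X_power_mult_reverse_seq_poly:
  assumes n: "n > 0" and per: "\<And>i. s (i + n) = s i"
  shows "[X ^ j * (seq_poly n s \<circ>\<^sub>p X ^ (n - 1)) = seq_poly n (\<lambda>k. s (k + j)) \<circ>\<^sub>p X ^ (n - 1)] (mod cyclic_modulus n)"
proof (induction j)
  case (Suc j)
  let ?m = "cyclic_modulus n" and ?y = "X ^ (n - 1)"
  let ?W = "\<lambda>a. seq_poly n a \<circ>\<^sub>p ?y"
  obtain l where l: "n = Suc l" using n gr0_implies_Suc by blast
  have W: "?W a = (\<Sum>k<n. smult (a k) (?y ^ k))" for a
    by (simp add: seq_poly_def pcompose_sum pcompose_smult pcompose_X_power)
  have Xy: "[X * ?y ^ Suc k = ?y ^ k] (mod ?m)" for k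
  proof -
    have "[(X * ?y) * ?y ^ k = 1 * ?y ^ k] (mod ?m)"
      using X_power_cong_1[of n] by (intro cong_mult) (auto simp: l)
    then show ?thesis by (simp add: ac_simps)
  qed
  \<comment> \<open>The constant term wraps around: \<open>?y\<close> is the inverse of X and l = n
    - 1 is -1 modulo n. It becomes the top term, whose coefficient s (n + j) equals s j by
    periodicity.\<close>
  have Xl: "[X = ?y ^ l] (mod ?m)"
  proof -
    have "[X ^ 1 = X ^ ((n - 1) * l)] (mod ?m)"
    proof (rule X_power_cong)
      have "[int l * int l = (- 1) * (- 1)] (mod int n)"
        by (intro cong_mult) (simp_all add: l cong_iff_dvd_diff add.commute)
      then show "[1 = (n - 1) * l] (mod n)"
        by (simp add: l cong_sym flip: cong_int_iff)
    qed
    then show ?thesis by (simp add: power_mult)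
  qed
  let ?a = "\<lambda>k. s (k + j)"
  have "X * ?W ?a = smult (?a 0) X + (\<Sum>k<l. smult (?a (Suc k)) (X * ?y ^ Suc k))"
    unfolding W unfolding l sum.lessThan_Suc_shift
    by (simp add: distrib_left sum_distrib_left)
  also have "[\<dots> = smult (?a 0) (?y ^ l) + (\<Sum>k<l. smult (?a (Suc k)) (?y ^ k))] (mod ?m)"
  proof -
    have sm: "[smult c q = smult c r] (mod ?m)" if "[q = r] (mod ?m)" for c q r
      using cong_scalar_left[OF that, of "[:c:]"] by simp
    show ?thesis by (intro cong_add cong_sum sm Xl Xy)
  qed
  also have "smult (?a 0) (?y ^ l) + (\<Sum>k<l. smult (?a (Suc k)) (?y ^ k)) = ?W (\<lambda>k. s (k + Suc j))"
    using per[of j] unfolding W unfolding l sum.lessThan_Suc by (simp add: add.commute)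
  finally have 1: "[X * ?W ?a = ?W (\<lambda>k. s (k + Suc j))] (mod ?m)" .
  have "[X * (X ^ j * ?W s) = X * ?W ?a] (mod ?m)"
    using Suc by (rule cong_scalar_left)
  also note 1
  finally show ?case by (simp add: mult.assoc)
qed simp

text \<open>Reversal is an involution because (n - 1)^2 = 1 modulo n, so \<open>seq_poly n a\<close>
  itself is divisible by X^n - 1. Its degree is too small for that unless it is 0.\<close>

lemma reverse_seq_poly_cong_0:
  assumes n: "n > 0" and "[seq_poly n a \<circ>\<^sub>p X ^ (n - 1) = 0] (mod cyclic_modulus n)" and "k < n"
  shows "a k = 0"
proof -
  let ?m = "cyclic_modulus n" and ?y = "X ^ (n - 1)"
  have "[int (n - 1) * int (n - 1) = (- 1) * (- 1)] (mod int n)"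
    using n by (intro cong_mult) (simp_all add: cong_iff_dvd_diff of_nat_diff)
  then have "[(n - 1) * (n - 1) = 1] (mod n)"
    by (simp flip: cong_int_iff)
  then have "[seq_poly n a \<circ>\<^sub>p ?y \<circ>\<^sub>p ?y = seq_poly n a] (mod ?m)"
    by (rule pcompose_X_power_pcompose)
  moreover have "[seq_poly n a \<circ>\<^sub>p ?y \<circ>\<^sub>p ?y = 0 \<circ>\<^sub>p ?y] (mod ?m)"
    by (intro pcompose_X_power_cong assms)
  ultimately have "?m dvd seq_poly n a" by (metis cong_0_iff cong_dvd_iff pcompose_0)
  then have "seq_poly n a = 0"
    using poly_below_cong_0 seq_poly_below n by (metis degree_cyclic_modulus)
  then show ?thesis using coeff_seq_poly[of n a k] assms by simp
qed

text \<open>Multiplying the reversed polynomial by X shifts s, so the product is the reversed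
  polynomial of the sequence of sums on the right. It vanishes exactly when these sums vanish for
  indices below n, and periodicity covers the rest.\<close>

lemma seq_poly_mult_reverse_cong_0_iff:
  assumes n: "n > 0" and per: "\<And>i. s (i + n) = s i"
  shows "cyclic_modulus n dvd seq_poly l c * (seq_poly n s \<circ>\<^sub>p X ^ (n - 1)) \<longleftrightarrow>
    (\<forall>i. (\<Sum>j<l. c j * s (i + j)) = 0)"
proof -
  let ?m = "cyclic_modulus n" and ?y = "X ^ (n - 1)"
  let ?a = "\<lambda>k. \<Sum>j<l. c j * s (k + j)"
  have "seq_poly l c * (seq_poly n s \<circ>\<^sub>p ?y) = (\<Sum>j<l. [:c j:] * (X ^ j * (seq_poly n s \<circ>\<^sub>p ?y)))"
    by (simp add: seq_poly_def[of l] sum_distrib_right)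
  also have "[\<dots> = (\<Sum>j<l. [:c j:] * (seq_poly n (\<lambda>k. s (k + j)) \<circ>\<^sub>p ?y))] (mod ?m)"
    by (intro cong_sum cong_scalar_left X_power_mult_reverse_seq_poly n per)
  also have "(\<Sum>j<l. [:c j:] * (seq_poly n (\<lambda>k. s (k + j)) \<circ>\<^sub>p ?y)) =
      (\<Sum>j<l. smult (c j) (seq_poly n (\<lambda>k. s (k + j)))) \<circ>\<^sub>p ?y"
    by (simp add: pcompose_sum pcompose_smult)
  also have "(\<Sum>j<l. smult (c j) (seq_poly n (\<lambda>k. s (k + j)))) = seq_poly n ?a"
    by (rule poly_eqI) (simp add: coeff_sum coeff_seq_poly)
  finally have "?m dvd seq_poly l c * (seq_poly n s \<circ>\<^sub>p ?y) \<longleftrightarrow> [seq_poly n ?a \<circ>\<^sub>p ?y = 0] (mod ?m)"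
    by (simp add: cong_dvd_iff cong_0_iff)
  also have "\<dots> \<longleftrightarrow> (\<forall>i. ?a i = 0)"
  proof
    assume L: "[seq_poly n ?a \<circ>\<^sub>p ?y = 0] (mod ?m)"
    have per': "s (i + q * n) = s i" for i q
    proof (induction q)
      case (Suc q)
      then show ?case using per[of "i + q * n"] by (simp add: ac_simps)
    qed simp
    show "\<forall>i. ?a i = 0"
    proof
      fix i
      have "?a i = ?a (i mod n)"
      proof (rule sum.cong)
        fix j
        have "i + j = i mod n + j + i div n * n" by (simp add: add.assoc add.left_commute)
        then show "c j * s (i + j) = c j * s (i mod n + j)" using per' by metis
      qed simp
      then show "?a i = 0" using reverse_seq_poly_cong_0[OF n L, of "i mod n"] n by simp
    qed
  qed (simp add: seq_poly_def)
  finally show ?thesis .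
qed

text \<open>Registers of length l correspond to their characteristic polynomials of degree l; over
  F_2 every nonzero polynomial is monic.\<close>

lemma linear_complexity_eq_Least:
  assumes n: "n > 0" and per: "\<And>i. s (i + n) = s i"
  shows "linear_complexity s =
    (LEAST l. \<exists>q. q \<noteq> 0 \<and> degree q = l \<and> cyclic_modulus n dvd q * (seq_poly n s \<circ>\<^sub>p X ^ (n - 1)))"
proof -
  let ?Q = "\<lambda>q. cyclic_modulus n dvd q * (seq_poly n s \<circ>\<^sub>p X ^ (n - 1))"
  have "(\<exists>c. lfsr_generates l c s) \<longleftrightarrow> (\<exists>q. q \<noteq> 0 \<and> degree q = l \<and> ?Q q)" for l
  proof
    assume "\<exists>c. lfsr_generates l c s"
    then obtain c where c: "\<And>i. s (i + l) = (\<Sum>j<l. c j * s (i + j))" by (auto simp: lfsr_generates_def)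
    \<comment> \<open>The leading coefficient 1 brings s (i + l) to the side of the feedback sum;
      signs do not matter in characteristic 2.\<close>
    define q where "q = seq_poly (Suc l) (c(l := 1))"
    have cl: "coeff q l = 1" by (simp add: q_def coeff_seq_poly)
    have "degree q = l"
    proof (rule antisym)
      show "degree q \<le> l" by (rule degree_le) (simp add: q_def coeff_seq_poly)
      show "l \<le> degree q" using cl by (intro le_degree) simp
    qed
    moreover have "q \<noteq> 0" using cl by auto
    moreover have "?Q q"
      unfolding q_def using c
      by (subst seq_poly_mult_reverse_cong_0_iff[where s = s, OF n per]) (simp_all flip: mult_2)
    ultimately show "\<exists>q. q \<noteq> 0 \<and> degree q = l \<and> ?Q q" by blast
  next
    assume "\<exists>q. q \<noteq> 0 \<and> degree q = l \<and> ?Q q"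
    then obtain q where q: "q \<noteq> 0" "degree q = l" "?Q q" by blast
    have lc: "coeff q l = 1" using q by (metis bit_not_zero_iff leading_coeff_0_iff)
    have "seq_poly (Suc l) (coeff q) = q"
      by (rule poly_eqI) (auto simp: coeff_seq_poly q(2) coeff_eq_0)
    then have z: "(\<Sum>j<l. coeff q j * s (i + j)) + s (i + l) = 0" for i
      using q(3) seq_poly_mult_reverse_cong_0_iff[where s = s, OF n per, of "Suc l" "coeff q"] lc by simp
    have "b = a" if "a + b = 0" for a b :: bit
      using that by (cases a; cases b) simp_all
    then have "lfsr_generates l (coeff q) s" using z unfolding lfsr_generates_def by blast
    then show "\<exists>c. lfsr_generates l c s" by blast
  qed
  then show ?thesis by (simp add: linear_complexity_def)
qed

lemma card_annihilator_seq_poly: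
  assumes n: "n > 0" and per: "\<And>i. s (i + n) = s i"
  shows "linear_complexity s \<le> n"
    and "card (annihilator (cyclic_modulus n) (seq_poly n s)) = 2 ^ (n - linear_complexity s)"
proof -
  let ?t = "seq_poly n s \<circ>\<^sub>p X ^ (n - 1)"
  note * = card_annihilator_Least[OF cyclic_modulus_nonzero[OF n], of ?t]
    linear_complexity_eq_Least[where s = s, OF n per]
  show "linear_complexity s \<le> n" using * n by simp
  have "coprime (n - 1) n" using n coprime_diff_one_left_nat by blast
  then show "card (annihilator (cyclic_modulus n) (seq_poly n s)) = 2 ^ (n - linear_complexity s)"
    using * n card_annihilator_pcompose[OF n, of "n - 1"] by simp
qed


section \<open>Indicator polynomials of sets of residues\<close>

definition set_poly :: "nat set \<Rightarrow> bit poly" where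
  "set_poly A = (\<Sum>k\<in>A. X ^ k)"

text \<open>Cross terms cancel in characteristic 2, so squaring doubles exponents.\<close>

lemma set_poly_square: "finite A \<Longrightarrow> set_poly A * set_poly A = (\<Sum>k\<in>A. X ^ (2 * k))"
proof (induction rule: finite_induct)
  case (insert k A)
  have "(X ^ k + set_poly A) * (X ^ k + set_poly A) = X ^ k * X ^ k + set_poly A * set_poly A"
    by (simp add: algebra_simps)
  then show ?case
    using insert by (simp add: set_poly_def mult_2 power_add)
qed (simp add: set_poly_def)

lemma sum_X_power_cong_set_poly:
  assumes "bij_betw (\<lambda>k. u * k mod n) A B"
  shows "[(\<Sum>k\<in>A. X ^ (u * k)) = set_poly B] (mod cyclic_modulus n)"
proof -
  have "[(\<Sum>k\<in>A. X ^ (u * k)) = (\<Sum>k\<in>A. X ^ (u * k mod n))] (mod cyclic_modulus n)"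
    by (intro cong_sum X_power_cong) simp
  also have "(\<Sum>k\<in>A. X ^ (u * k mod n)) = set_poly B"
    unfolding set_poly_def using assms by (rule sum.reindex_bij_betw)
  finally show ?thesis .
qed

text \<open>X fixes the all-ones polynomial J because (X - 1)J = X^n - 1. Hence q acts on J as the
  scalar q(1).\<close>

lemma mult_all_ones_cong:
  "[q * set_poly {..<n} = [:poly q 1:] * set_poly {..<n}] (mod cyclic_modulus n)"
proof (induction q)
  case (pCons c q)
  let ?j = "set_poly {..<n}"
  have "X * ?j - ?j = cyclic_modulus n"
    unfolding cyclic_modulus_def set_poly_def power_diff_1_eq by (simp only: left_diff_distrib mult_1_left)
  then have Xj: "[X * ?j = ?j] (mod cyclic_modulus n)"
    by (simp only: cong_iff_dvd_diff dvd_refl)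
  have "[[:c:] * ?j + X * (q * ?j) = [:c:] * ?j + X * ([:poly q 1:] * ?j)] (mod cyclic_modulus n)"
    by (intro cong_add cong_scalar_left pCons cong_refl)
  also have "[:c:] * ?j + X * ([:poly q 1:] * ?j) = [:c:] * ?j + [:poly q 1:] * (X * ?j)"
    by (simp only: mult.left_commute)
  also have "[[:c:] * ?j + [:poly q 1:] * (X * ?j) = [:c:] * ?j + [:poly q 1:] * ?j] (mod cyclic_modulus n)"
    by (intro cong_add cong_scalar_left Xj cong_refl)
  also have "[:c:] * ?j + [:poly q 1:] * ?j = [:poly (pCons c q) 1:] * ?j"
    by (simp flip: smult_add_left)
  finally show ?case by (simp add: pCons_eq_iff mult_pCons_left)
qed simp

lemma of_nat_bit_odd: "odd k \<Longrightarrow> of_nat k = (1 :: bit)"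
  by (metis bit_not_zero_iff even_of_nat_iff even_zero)

text \<open>Isolates what cyclotomy must supply: \<open>double\<close> gives idempotence,
  \<open>half\<close> relates C to its complement, and the odd size of C makes its polynomial take
  the value 1 at 1.\<close>

lemma linear_complexity_half:
  assumes n: "odd n" and C: "C \<subseteq> {..<n}" "0 \<in> C" "odd (card C)"
    and double: "bij_betw (\<lambda>k. 2 * k mod n) C C"
    and u: "coprime u n" and half: "bij_betw (\<lambda>k. u * k mod n) (C - {0}) ({..<n} - C)"
    and s: "\<And>i. s i = (if i mod n \<in> C then 1 else 0)"
  shows "2 * linear_complexity s = n + 1"
proof -
  have n0: "n > 0" using n by (rule odd_pos)
  have per: "s (i + n) = s i" for i by (simp add: s)
  have fin: "finite C" using C(1) finite_subset by blast
  let ?m = "cyclic_modulus n" and ?j = "set_poly {..<n}" and ?t = "set_poly C \<circ>\<^sub>p X ^ u"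
  let ?K = "set_poly ({..<n} - C)"
  have seq: "seq_poly n s = set_poly C"
  proof -
    have "seq_poly n s = (\<Sum>k<n. if k \<in> C then X ^ k else 0)"
      unfolding seq_poly_def by (intro sum.cong) (auto simp: s)
    also have "\<dots> = set_poly C"
      unfolding set_poly_def using C(1) by (simp add: sum.inter_restrict[symmetric] Int_absorb1)
    finally show ?thesis .
  qed
  have j_split: "?j = set_poly C + ?K"
    unfolding set_poly_def using C(1) by (metis add.commute finite_lessThan sum.subset_diff)
  have C_split: "set_poly C = 1 + set_poly (C - {0})"
    unfolding set_poly_def using C(2) fin by (simp add: sum.remove)
  have idem: "[set_poly C * set_poly C = set_poly C] (mod ?m)"
    using sum_X_power_cong_set_poly[OF double] set_poly_square[OF fin] by simp
  have t: "[?t = 1 + ?K] (mod ?m)"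
  proof -
    have "?t = 1 + (\<Sum>k\<in>C - {0}. X ^ (u * k))"
      unfolding C_split
      by (simp add: set_poly_def pcompose_add pcompose_1 pcompose_sum pcompose_X_power power_mult)
    then show ?thesis using sum_X_power_cong_set_poly[OF half] by (auto intro: cong_add)
  qed
  have poly_C: "poly (set_poly C) 1 = 1"
    using of_nat_bit_odd[OF C(3)] by (simp add: set_poly_def poly_sum)
  have ones: "[q * ?j = (if poly q 1 = 0 then 0 else ?j)] (mod ?m)" for q
    using mult_all_ones_cong[of q n] by (cases "poly q 1") auto
  have j: "?j = seq_poly n (\<lambda>_. 1)" by (simp add: set_poly_def seq_poly_def)
  have "card (annihilator ?m (1 + set_poly C)) = card (annihilator ?m (?t + ?j))"
  proof -
    have "[?t + ?j = (1 + ?K) + (set_poly C + ?K)] (mod ?m)"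
      unfolding j_split by (intro cong_add t cong_refl)
    also have "(1 + ?K) + (set_poly C + ?K) = 1 + set_poly C"
      by (simp add: algebra_simps)
    finally show ?thesis by (simp add: annihilator_cong)
  qed
  also have "\<dots> = 2 * card (annihilator ?m ?t)"
  proof (rule card_annihilator_add)
    show "?j \<in> poly_below (degree ?m)" using seq_poly_below n0 by (simp add: j)
    have "coeff ?j 0 = 1" using n0 by (simp add: j coeff_seq_poly)
    then show "?j \<noteq> 0" by auto
    show "[?t * ?j = ?j] (mod ?m)" using ones[of ?t] by (simp add: poly_pcompose poly_C)
    have "poly ?j 1 = 1" using of_nat_bit_odd[OF n] by (simp add: set_poly_def poly_sum)
    then show "[?j * ?j = ?j] (mod ?m)" using ones[of ?j] by simp
    show "[a * ?j = 0] (mod ?m) \<or> [a * ?j = ?j] (mod ?m)" for a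
      using ones[of a] by (simp split: if_splits)
  qed
  also have "card (annihilator ?m ?t) = card (annihilator ?m (set_poly C))"
    by (rule card_annihilator_pcompose[OF n0 u])
  finally have "card (annihilator ?m (set_poly C)) * (2 * card (annihilator ?m (set_poly C))) = 2 ^ n"
    using card_annihilator_idempotent[OF cyclic_modulus_nonzero[OF n0] idem] n0 by simp
  then have "2 ^ (n - linear_complexity s) * (2 * 2 ^ (n - linear_complexity s)) = (2 ^ n :: nat)"
    using card_annihilator_seq_poly(2)[where s = s, OF n0 per] seq by simp
  then have "(2::nat) ^ ((n - linear_complexity s) + Suc (n - linear_complexity s)) = 2 ^ n"
    by (simp only: power_add power_Suc)
  then have "(n - linear_complexity s) + Suc (n - linear_complexity s) = n"
    by (rule power_inject_exp[THEN iffD1, rotated]) simp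
  \<comment> \<open>The bound by n makes the truncated difference n - L a true one, so 2(n - L) + 1
    = n can be solved for L.\<close>
  then show ?thesis using card_annihilator_seq_poly(1)[where s = s, OF n0 per] by linarith
qed

section \<open>Generalized cyclotomic classes\<close>

text \<open>Both factors of a^p - 1 = (a - 1)(1 + a + ... + a^(p-1)) are divisible by p, the second
  being a sum of p terms congruent to 1.\<close>

lemma cong_one_power_prime:
  fixes a :: nat
  assumes "[a = 1] (mod p)"
  shows "[a ^ p = 1] (mod p\<^sup>2)"
proof -
  have a: "[int a = 1] (mod int p)" using assms by (metis cong_int_iff of_nat_1)
  have "[(\<Sum>i<p. int a ^ i) = (\<Sum>i<p. 1 ^ i)] (mod int p)"
    by (intro cong_sum cong_pow a)
  then have "int p dvd (\<Sum>i<p. int a ^ i)" by (simp add: cong_dvd_iff)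
  moreover have "int p dvd int a - 1" using a by (simp add: cong_iff_dvd_diff)
  ultimately have "int p * int p dvd (int a - 1) * (\<Sum>i<p. int a ^ i)" by (rule mult_dvd_mono[rotated])
  then have "[int a ^ p = 1] (mod (int p)\<^sup>2)"
    by (simp add: cong_iff_dvd_diff power_diff_1_eq power2_eq_square)
  then show ?thesis by (metis cong_int_iff of_nat_1 of_nat_power)
qed

section \<open>Classes described by exponents\<close>

text \<open>Selects the exponents belonging to the characteristic set: \<open>d\<close> will be p f
  for the units g^n and f for the multiples p g^n.\<close>

definition upper_half :: "nat \<Rightarrow> nat \<Rightarrow> nat \<Rightarrow> bool" where
  "upper_half d b n \<longleftrightarrow> (\<exists>i<d div 2. [n = i + b] (mod d))"

lemma upper_half_cong: "[m = n] (mod d) \<Longrightarrow> upper_half d b m = upper_half d b n"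
  by (simp add: upper_half_def cong_def)

text \<open>Integers are used so that n - b keeps its meaning when n < b.\<close>

lemma upper_half_iff:
  assumes "d > 0"
  shows "upper_half d b n \<longleftrightarrow> (int n - int b) mod int d < int (d div 2)"
proof
  assume "upper_half d b n"
  then obtain i where i: "i < d div 2" "[n = i + b] (mod d)" by (auto simp: upper_half_def)
  then have "[int n = int i + int b] (mod int d)" by (metis cong_int_iff of_nat_add)
  then have "[int n - int b = int i + int b - int b] (mod int d)" by (intro cong_diff cong_refl)
  then have "(int n - int b) mod int d = int i mod int d" by (simp add: cong_def)
  then show "(int n - int b) mod int d < int (d div 2)" using i by simp
next
  assume L: "(int n - int b) mod int d < int (d div 2)"
  define i where "i = nat ((int n - int b) mod int d)"
  have i: "int i = (int n - int b) mod int d" using assms by (simp add: i_def)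
  then have "[int i + int b = int n - int b + int b] (mod int d)" by (intro cong_add) auto
  then have "[n = i + b] (mod d)"
    by (metis cong_int_iff cong_sym diff_add_cancel of_nat_add)
  moreover have "i < d div 2" using L i by linarith
  ultimately show "upper_half d b n" unfolding upper_half_def by blast
qed

text \<open>Adding d/2 exchanges the residues of n - b in [0, d/2) with those in [d/2, d).\<close>

lemma upper_half_shift:
  assumes "even d" "d > 0"
  shows "upper_half d b (n + d div 2) \<longleftrightarrow> \<not> upper_half d b n"
proof -
  obtain h where h: "d = 2 * h" using assms by blast
  then have "h > 0" using assms by simp
  define x where "x = int n - int b"
  define r where "r = x mod (2 * int h)"
  have r: "0 \<le> r" "r < 2 * int h" using \<open>h > 0\<close> by (simp_all add: r_def)
  have x: "(int n - int b) mod (2 * int h) = r" by (simp add: r_def x_def)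
  have "(int (n + h) - int b) mod (2 * int h) = (r + int h) mod (2 * int h)"
  proof -
    have "int (n + h) - int b = x + int h" by (simp add: x_def)
    then show ?thesis by (simp only: r_def mod_add_left_eq)
  qed
  also have "(r + int h) mod (2 * int h) = (if r < int h then r + int h else r - int h)"
  proof (cases "r < int h")
    case False
    have "(r + int h) mod (2 * int h) = (r - int h) mod (2 * int h)"
      using minus_mod_self2[of "r + int h" "2 * int h"] by (simp only: mult_2 add_diff_cancel_right)
    also have "\<dots> = r - int h" using False r by simp
    finally show ?thesis using False by simp
  qed (use r in simp)
  finally have xh: "(int (n + h) - int b) mod (2 * int h) = (if r < int h then r + int h else r - int h)" .
  have d: "d div 2 = h" "int d = 2 * int h" by (simp_all add: h)
  show ?thesis
    unfolding upper_half_iff[OF assms(2)] d xh x using r by simp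
qed

lemma cyc_class_eq:
  assumes ord: "ord (p ^ j) g = cyc_d p f j * e" and pos: "cyc_d p f j * e > 0"
  shows "cyc_class p e f g j i = {g ^ n mod p ^ j | n. [n = i] (mod cyc_d p f j)}"
proof -
  let ?d = "cyc_d p f j" and ?q = "p ^ j"
  have cop: "coprime ?q g" using ord pos by (metis less_irrefl ord_eq_0)
  have "cyc_class p e f g j i = {g ^ (i + ?d * t) mod ?q | t. t < e}"
    unfolding cyc_class_def cyc_class0_def
    by (auto simp: mod_mult_right_eq power_add) (metis mod_mult_right_eq)
  also have "\<dots> = {g ^ n mod ?q | n. [n = i] (mod ?d)}"
  proof (intro equalityI subsetI)
    fix x assume "x \<in> {g ^ (i + ?d * t) mod ?q | t. t < e}"
    then obtain t where "x = g ^ (i + ?d * t) mod ?q" by blast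
    moreover have "[i + ?d * t = i] (mod ?d)" by (simp add: cong_def)
    ultimately show "x \<in> {g ^ n mod ?q | n. [n = i] (mod ?d)}" by blast
  next
    fix x assume "x \<in> {g ^ n mod ?q | n. [n = i] (mod ?d)}"
    then obtain n where n: "x = g ^ n mod ?q" "[n = i] (mod ?d)" by blast
    \<comment> \<open>A multiple of the order is added to lift the exponent to at least i, so that
      its excess over i is a natural multiple of d.\<close>
    have "[n + i * e * ?d = i] (mod ?d)" using n(2) by (simp add: cong_def)
    moreover have "i \<le> n + i * e * ?d"
    proof -
      have "i * 1 \<le> i * (?d * e)" using pos by (intro mult_le_mono2) linarith
      then have "i \<le> i * e * ?d" by (simp only: mult_1_right ac_simps)
      then show ?thesis by (rule trans_le_add2)
    qed
    ultimately obtain s where s: "n + i * e * ?d = s * ?d + i" using cong_le_nat by blast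
    have "[n = n + i * (?d * e)] (mod ?d * e)" by (simp add: cong_def)
    also have "n + i * (?d * e) = i + ?d * s" using s by (simp add: ac_simps)
    also have "[i + ?d * s = i + ?d * (s mod e)] (mod ?d * e)"
      by (intro cong_add cong_refl cong_cmult_leftI) simp
    finally have "[g ^ n = g ^ (i + ?d * (s mod e))] (mod ?q)"
      using order_divides_expdiff[OF cop] ord by simp
    then have "x = g ^ (i + ?d * (s mod e)) mod ?q" using n(1) by (simp add: cong_def)
    moreover have "s mod e < e" using pos by simp
    ultimately show "x \<in> {g ^ (i + ?d * t) mod ?q | t. t < e}" by blast
  qed
  finally show ?thesis .
qed

lemma Union_cyc_class:
  assumes "ord (p ^ j) g = cyc_d p f j * e" and "cyc_d p f j * e > 0"
  shows "(\<Union>i\<in>{0..<cyc_d p f j div 2}. cyc_class p e f g j ((i + b) mod cyc_d p f j)) =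
    {g ^ n mod p ^ j | n. upper_half (cyc_d p f j) b n}"
  unfolding cyc_class_eq[OF assms] upper_half_def by (auto; blast)

lemma bij_betw_mult_mod:
  fixes w n :: nat
  assumes "coprime w n" "n > 0"
  shows "bij_betw (\<lambda>k. w * k mod n) {0<..<n} {0<..<n}"
proof -
  have inj: "inj_on (\<lambda>k. w * k mod n) {0<..<n}"
  proof (rule inj_onI)
    fix x y assume "x \<in> {0<..<n}" "y \<in> {0<..<n}" "w * x mod n = w * y mod n"
    moreover from this have "[x = y] (mod n)" using assms(1) by (simp add: cong_mult_lcancel_nat flip: cong_def)
    ultimately show "x = y" by (simp add: cong_less_modulus_unique_nat)
  qed
  have "w * x mod n \<in> {0<..<n}" if "x \<in> {0<..<n}" for x
  proof -
    have "\<not> n dvd w * x"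
      using that assms(1) by (metis coprime_commute coprime_dvd_mult_right_iff greaterThanLessThan_iff nat_dvd_not_less)
    then show ?thesis using assms(2) by (simp add: mod_greater_zero_iff_not_dvd)
  qed
  then have "(\<lambda>k. w * k mod n) ` {0<..<n} = {0<..<n}"
    by (intro endo_inj_surj inj) blast+
  then show ?thesis using inj by (simp add: bij_betw_def)
qed

text \<open>Applied with A = B for doubling and with B the complement of A for the half-period
  multiplier.\<close>

lemma bij_betw_restrict_iff:
  assumes "bij_betw h U U" and "\<And>x. x \<in> U \<Longrightarrow> h x \<in> B \<longleftrightarrow> x \<in> A"
  shows "bij_betw h (U \<inter> A) (U \<inter> B)"
proof -
  have "h ` (U \<inter> A) = U \<inter> B"
  proof (intro equalityI subsetI)
    fix y assume y: "y \<in> U \<inter> B"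
    then have "y \<in> h ` U" using assms(1) by (simp add: bij_betw_def)
    then show "y \<in> h ` (U \<inter> A)" using y assms(2) by auto
  qed (use assms bij_betwE in blast)
  then show ?thesis using assms(1) by (auto simp: bij_betw_def intro: inj_on_subset)
qed

section \<open>The characteristic set modulo the square of p\<close>

locale cyclotomic =
  fixes p e f g b :: nat
  assumes p: "prime p" "odd p" and ef: "e * f = p - 1" and f: "even f"
    and g: "residue_primroot (p\<^sup>2) g" and two: "[2 ^ e = 1] (mod p\<^sup>2)"
begin

abbreviation "C \<equiv> char_set p e f g b"

lemma p_gt_2: "p > 2"
  using prime_ge_2_nat[OF p(1)] p(2) by (cases "p = 2") auto

lemma e_pos: "e > 0" and f_pos: "f > 0"
  using ef p_gt_2 by (cases "e = 0"; cases "f = 0"; simp)+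

lemma coprime_g: "coprime (p\<^sup>2) g" and coprime_p_g: "coprime p g"
  using g by (auto simp: residue_primroot_def)

lemma totient_p2: "totient (p\<^sup>2) = p * f * e"
proof -
  have "totient (p\<^sup>2) = p ^ (2 - 1) * (p - 1)" by (rule totient_prime_power) (use p in auto)
  also have "\<dots> = p ^ (2 - 1) * (e * f)" by (simp only: ef)
  finally show ?thesis by (simp add: ac_simps)
qed

lemma ord_p2: "ord (p\<^sup>2) g = p * f * e"
  using g totient_p2 by (simp add: residue_primroot_def)

text \<open>A primitive root modulo p^2 is one modulo p: if g^h = 1 modulo p, then g^(hp) = 1 modulo
  p^2, so p f e divides h p.\<close>

lemma ord_p: "ord p g = f * e"
proof (rule dvd_antisym)
  show "ord p g dvd f * e"
    using order_divides_totient[OF coprime_p_g] ef totient_prime[OF p(1)] by (simp add: mult.commute)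
  have "[g ^ (ord p g * p) = 1] (mod p\<^sup>2)"
    unfolding power_mult by (rule cong_one_power_prime) (rule ord)
  then have "p * (f * e) dvd p * ord p g"
    by (simp only: ord_divides ord_p2 ac_simps)
  then show "f * e dvd ord p g" using p_gt_2 by simp
qed

text \<open>In this form multiplication by g^k is just the shift of exponents from n to n +
  k.\<close>

lemma char_set_eq:
  "C = {0} \<union> {p * g ^ n mod p\<^sup>2 | n. upper_half f b n} \<union> {g ^ n mod p\<^sup>2 | n. upper_half (p * f) b n}"
proof -
  have "(\<Union>i\<in>{0..<f div 2}. cyc_class p e f g 1 ((i + b) mod f)) = {g ^ n mod p | n. upper_half f b n}"
    using Union_cyc_class[of p 1 g f e b] ord_p e_pos f_pos by (simp add: cyc_d_def)
  then have "(\<Union>i\<in>{0..<f div 2}. (\<lambda>x. p * x) ` cyc_class p e f g 1 ((i + b) mod f)) =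
      (\<lambda>x. p * x) ` {g ^ n mod p | n. upper_half f b n}"
    by (simp only: image_UN[symmetric])
  also have "\<dots> = {p * g ^ n mod p\<^sup>2 | n. upper_half f b n}"
    by (auto simp: power2_eq_square)
  finally show ?thesis
    using Union_cyc_class[of p 2 g f e b] ord_p2 e_pos f_pos p_gt_2
    by (simp add: char_set_def cyc_d_def)
qed

lemma not_dvd_power: "\<not> p dvd g ^ n mod p\<^sup>2"
proof
  assume "p dvd g ^ n mod p\<^sup>2"
  then have "p dvd g ^ n" by (metis dvd_mod_iff dvd_power zero_less_numeral)
  then show False using coprime_p_g p prime_dvd_power by (metis coprime_absorb_left not_prime_unit)
qed

lemma dvd_p_power: "p dvd p * g ^ n mod p\<^sup>2"
  by (simp add: dvd_mod)

lemma p_power_eq_iff: "p * g ^ n mod p\<^sup>2 = p * g ^ m mod p\<^sup>2 \<longleftrightarrow> [n = m] (mod (f * e))"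
proof -
  have "p * g ^ n mod p\<^sup>2 = p * g ^ m mod p\<^sup>2 \<longleftrightarrow> [g ^ n = g ^ m] (mod p)"
    using p_gt_2 by (auto simp: power2_eq_square cong_def)
  then show ?thesis using order_divides_expdiff[OF coprime_p_g] ord_p by simp
qed

lemma p_power_mod_pos: "p * g ^ n mod p\<^sup>2 \<noteq> 0"
proof
  assume "p * g ^ n mod p\<^sup>2 = 0"
  then have "p dvd g ^ n" using p_gt_2 by (simp add: power2_eq_square mod_eq_0_iff_dvd)
  then show False using not_dvd_power[of n] by (metis dvd_mod dvd_power zero_less_numeral)
qed

lemma power_in_char_set: "g ^ n mod p\<^sup>2 \<in> C \<longleftrightarrow> upper_half (p * f) b n"
proof
  assume "g ^ n mod p\<^sup>2 \<in> C"
  then obtain m where m: "g ^ n mod p\<^sup>2 = g ^ m mod p\<^sup>2" "upper_half (p * f) b m"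
    using not_dvd_power[of n] dvd_p_power unfolding char_set_eq by fastforce
  then have "[n = m] (mod p * f * e)"
    using order_divides_expdiff[OF coprime_g] ord_p2 by (simp add: cong_def)
  then show "upper_half (p * f) b n" using m(2) upper_half_cong cong_modulus_mult_nat by blast
qed (auto simp: char_set_eq)

lemma p_power_in_char_set: "p * g ^ n mod p\<^sup>2 \<in> C \<longleftrightarrow> upper_half f b n"
proof
  assume "p * g ^ n mod p\<^sup>2 \<in> C"
  then obtain m where m: "p * g ^ n mod p\<^sup>2 = p * g ^ m mod p\<^sup>2" "upper_half f b m"
    using not_dvd_power dvd_p_power[of n] p_power_mod_pos[of n] unfolding char_set_eq by fastforce
  then have "[n = m] (mod f * e)" by (simp add: p_power_eq_iff)
  then show "upper_half f b n" using m(2) upper_half_cong cong_modulus_mult_nat by blast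
qed (auto simp: char_set_eq)

lemma coprime_eq_power:
  assumes "coprime x p" "x < p\<^sup>2"
  shows "\<exists>n. x = g ^ n mod p\<^sup>2"
proof -
  have "x \<noteq> 0" using assms(1) p_gt_2 by (cases "x = 0") auto
  then have "x \<in> totatives (p\<^sup>2)" using assms by (simp add: in_totatives_iff)
  moreover have "p\<^sup>2 > 1" using p_gt_2 by (simp add: power2_eq_square one_less_mult)
  ultimately show ?thesis using residue_primroot_is_generator[OF _ g] by (auto simp: bij_betw_def)
qed

lemma nonzero_residue_cases:
  assumes "0 < x" "x < p\<^sup>2"
  obtains n where "x = g ^ n mod p\<^sup>2" | n where "x = p * g ^ n mod p\<^sup>2"
proof (cases "coprime x p")
  case True
  then show ?thesis using coprime_eq_power[of x] assms that by blast
next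
  case False
  then have "p dvd x" using p(1) by (metis coprime_commute prime_imp_coprime)
  then obtain y where y: "x = p * y" by blast
  then have y': "0 < y" "y < p" using assms by (simp_all add: power2_eq_square)
  \<comment> \<open>The cofactor y is a positive number below p, hence itself a unit modulo p^2 and
    a power of g there.\<close>
  then have "coprime y p" using p(1) by (metis coprime_commute nat_dvd_not_less prime_imp_coprime)
  moreover have "y < p\<^sup>2" using y'(2) by (rule less_le_trans) (simp add: power2_eq_square)
  ultimately obtain n where "y = g ^ n mod p\<^sup>2" using coprime_eq_power by blast
  then have "x mod p\<^sup>2 = p * g ^ n mod p\<^sup>2" using y by (simp add: mod_mult_right_eq)
  then show ?thesis using that(2) assms(2) by simp
qed

lemma power_mult_power_mod: "g ^ k * (g ^ n mod p\<^sup>2) mod p\<^sup>2 = g ^ (n + k) mod p\<^sup>2"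
  by (simp add: mod_mult_right_eq power_add mult.commute)

lemma power_mult_p_power_mod: "g ^ k * (p * g ^ n mod p\<^sup>2) mod p\<^sup>2 = p * g ^ (n + k) mod p\<^sup>2"
  by (simp add: mod_mult_right_eq power_add ac_simps)

text \<open>A multiple of p f is also one of f, so the shift by k preserves the class of units and
  of multiples of p alike.\<close>

lemma power_mult_in_char_set:
  assumes x: "0 < x" "x < p\<^sup>2" and k: "[k = 0] (mod (p * f))"
  shows "g ^ k * x mod p\<^sup>2 \<in> C \<longleftrightarrow> x \<in> C"
proof -
  have "[n + k = n + 0] (mod p * f)" for n using k by (intro cong_add cong_refl)
  then have 1: "[n + k = n] (mod p * f)" for n by simp
  then have 2: "[n + k = n] (mod f)" for n by (metis cong_modulus_mult_nat mult.commute)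
  from x show ?thesis
    by (cases rule: nonzero_residue_cases)
      (simp_all only: power_mult_power_mod power_mult_p_power_mod power_in_char_set
        p_power_in_char_set upper_half_cong[OF 1] upper_half_cong[OF 2])
qed

lemma half_period_mult_in_char_set:
  assumes x: "0 < x" "x < p\<^sup>2"
  shows "g ^ (p * f div 2) * x mod p\<^sup>2 \<in> C \<longleftrightarrow> x \<notin> C"
proof -
  have 1: "upper_half (p * f) b (n + p * f div 2) \<longleftrightarrow> \<not> upper_half (p * f) b n" for n
    using f f_pos p_gt_2 by (intro upper_half_shift) auto
  have 2: "upper_half f b (n + p * f div 2) \<longleftrightarrow> \<not> upper_half f b n" for n
  proof -
    obtain m where m: "p = 2 * m + 1" using p(2) by (auto elim: oddE)
    obtain h where h: "f = 2 * h" using f by auto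
    \<comment> \<open>As p is odd, half of p f is f/2 modulo f: one multiplier makes the half turn
      for both moduli.\<close>
    have "n + p * f div 2 = n + f div 2 + m * f" by (simp add: m h algebra_simps)
    then have "[n + p * f div 2 = n + f div 2] (mod f)" by (simp only: cong_def mod_mult_self1)
    then have "upper_half f b (n + p * f div 2) = upper_half f b (n + f div 2)" by (rule upper_half_cong)
    then show ?thesis by (simp only: upper_half_shift[OF f f_pos])
  qed
  from x show ?thesis
    by (cases rule: nonzero_residue_cases)
      (simp_all only: power_mult_power_mod power_mult_p_power_mod power_in_char_set
        p_power_in_char_set 1 2)
qed

lemma char_set_subset: "C \<subseteq> {..<p\<^sup>2}"
  unfolding char_set_eq using p_gt_2 by auto

lemma bij_betw_double: "bij_betw (\<lambda>k. 2 * k mod p\<^sup>2) C C"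
proof -
  have "coprime 2 p" "2 < p\<^sup>2" using p p_gt_2 by (auto simp: power2_eq_square intro: less_trans)
  then obtain k where k: "2 = g ^ k mod p\<^sup>2" using coprime_eq_power by blast
  then have k': "[2 = g ^ k] (mod p\<^sup>2)" by (metis cong_mod_right cong_refl)
  \<comment> \<open>With 2 = g^k, the hypothesis on 2^e makes the order p f e divide k e, hence p f
    divides k.\<close>
  then have "[g ^ (k * e) = 1] (mod p\<^sup>2)"
    using cong_trans[OF cong_pow[OF cong_sym[OF k']] two] by (simp only: power_mult)
  then have "p * f * e dvd k * e" by (simp only: ord_divides ord_p2)
  then have k0: "[k = 0] (mod p * f)" using e_pos by (simp add: cong_0_iff)
  have "2 * x mod p\<^sup>2 = g ^ k * x mod p\<^sup>2" for x
    using cong_scalar_right[OF k'] by (simp add: cong_def)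
  then have "bij_betw (\<lambda>k. 2 * k mod p\<^sup>2) ({0<..<p\<^sup>2} \<inter> C) ({0<..<p\<^sup>2} \<inter> C)"
    using power_mult_in_char_set[OF _ _ k0] p p_gt_2
    by (intro bij_betw_restrict_iff bij_betw_mult_mod) auto
  then have "bij_betw (\<lambda>k. 2 * k mod p\<^sup>2) (({0<..<p\<^sup>2} \<inter> C) \<union> {0}) (({0<..<p\<^sup>2} \<inter> C) \<union> {0})"
    by (rule bij_betw_combine) (auto simp: bij_betw_def)
  moreover have "({0<..<p\<^sup>2} \<inter> C) \<union> {0} = C"
    using char_set_subset by (auto simp: char_set_eq)
  ultimately show ?thesis by simp
qed

lemma bij_betw_half:
  "bij_betw (\<lambda>k. g ^ (p * f div 2) * k mod p\<^sup>2) (C - {0}) ({..<p\<^sup>2} - C)"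
proof -
  have "bij_betw (\<lambda>k. g ^ (p * f div 2) * k mod p\<^sup>2) ({0<..<p\<^sup>2} \<inter> C) ({0<..<p\<^sup>2} \<inter> (- C))"
    using half_period_mult_in_char_set coprime_g p_gt_2
    by (intro bij_betw_restrict_iff bij_betw_mult_mod) (auto simp: coprime_commute)
  moreover have "{0<..<p\<^sup>2} \<inter> C = C - {0}" using char_set_subset by auto
  moreover have "{0<..<p\<^sup>2} \<inter> (- C) = {..<p\<^sup>2} - C" by (auto simp: char_set_eq)
  ultimately show ?thesis by simp
qed

text \<open>Since C without 0 is as large as the complement of C, p^2 = 2|C| - 1. For p = 2m + 1
  this gives |C| = 2m(m + 1) + 1.\<close>

lemma odd_card_char_set: "odd (card C)"
proof -
  have fin: "finite C" using char_set_subset finite_subset by blast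
  have 0: "0 \<in> C" by (simp add: char_set_eq)
  have "card {..<p\<^sup>2} = card C + card ({..<p\<^sup>2} - C)"
    using char_set_subset by (metis card_lessThan card_Diff_subset card_mono fin finite_lessThan le_add_diff_inverse)
  moreover have "card ({..<p\<^sup>2} - C) = card C - 1"
    using bij_betw_same_card[OF bij_betw_half] 0 fin by simp
  moreover have "card C > 0" using 0 fin by (auto simp: card_gt_0_iff)
  ultimately have c: "p\<^sup>2 = 2 * card C - 1" by simp
  obtain m where "p = 2 * m + 1" using p(2) by (auto elim: oddE)
  then have "2 * card C = 2 * (2 * (m * (m + 1)) + 1)"
    using c \<open>card C > 0\<close> by (simp add: power2_eq_square algebra_simps)
  then have "card C = 2 * (m * (m + 1)) + 1"
    by (rule mult_left_cancel[THEN iffD1, rotated]) simp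
  then show ?thesis by simp
qed

end

theorem theorem2:
  fixes p e f r g b :: nat
  assumes "prime p" and "odd p"
    and "e dvd p - 1" and "f = (p - 1) div e"
    and "f = 2 ^ r" and "r \<ge> 1"
    and "residue_primroot (p\<^sup>2) g"
    and "b \<le> p * f - 1"
    and "[2 ^ e = 1] (mod p\<^sup>2)"
  shows "linear_complexity (cyc_seq p e f g b) = (p\<^sup>2 + 1) div 2"
proof -
  have "even f" using assms(5,6) by simp
  moreover have "e * f = p - 1" using assms(3,4) by simp
  ultimately interpret cyclotomic p e f g b
    using assms by unfold_locales
  have "2 * linear_complexity (cyc_seq p e f g b) = p\<^sup>2 + 1"
  proof (rule linear_complexity_half)
    show "coprime (g ^ (p * f div 2)) (p\<^sup>2)" using coprime_g by (simp add: coprime_commute)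
    show "0 \<in> char_set p e f g b" by (simp add: char_set_def)
  qed (use assms(2) in \<open>simp_all add: char_set_subset odd_card_char_set bij_betw_double bij_betw_half cyc_seq_def\<close>)
  then show ?thesis by simp
qed

end
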